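(* Let $P_{YZ}$ be a joint probability distribution of random variables $Y,Z$ with finite alphabets and let $\varepsilon\in[0,1)$. If $\bar\lambda^{\varepsilon}_{\min}(Y|Z)_P>\frac1{|Y|}$, then $$\bar\lambda^{\varepsilon}_{\min}(Y|Z)_P=\lambda^{\varepsilon}_{\min}(Y|Z)_P.$$
   Context: $|Y|$ denotes the alphabet size of $Y$; $\mathbb 1$ is the all-ones vector; $P_Z$ is the marginal of $P_{YZ}$; $\mathbb 1_YP_Z$ is the vector with entries $(y,z)\mapsto P_Z(z)$. Inequalities between vectors are entrywise and $\langle\cdot,\cdot\rangle$ is the Euclidean inner product. Define $\lambda^{\varepsilon}_{\min}(Y|Z)_P:=2^{-H^{\varepsilon}_{\min}(Y|Z)_P}$, where $H^\varepsilon_{\min}$ is the smooth min-entropy, given by the linear program $$\lambda^{\varepsilon}_{\min}(Y|Z)_P=\min\{\lambda:\ \lambda\,\mathbb 1_YP_Z\ge Q_{YZ},\ T_{YZ}\ge P_{YZ}-Q_{YZ},\ \langle\mathbb 1_{YZ},T_{YZ}\rangle\le\varepsilon,\ \langle\mathbb 1_{YZ},Q_{YZ}\rangle=1;\ \lambda,T_{YZ},Q_{YZ}\ge0\}.$$ $\bar\lambda^{\varepsilon}_{\min}(Y|Z)_P$ is the same optimization without the normalization condition $\langle\mathbb 1_{YZ},Q_{YZ}\rangle=1$; equivalently, $$\bar\lambda^{\varepsilon}_{\min}(Y|Z)_P=\min\{\lambda:\ \lambda\,\mathbb 1_YP_Z\ge P_{YZ}-T_{YZ},\ \langle\mathbb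 1_{YZ},T_{YZ}\rangle\le\varepsilon;\ \lambda\ge0,\ T_{YZ}\ge0\}.$$ *)

theory Defs
  imports "HOL-Probability.Probability"
begin

text \<open>
  The alphabets are finite types, and a vector over the alphabet of \<open>YZ\<close> has type
  \<open>real^('y \<times> 'z)\<close>, on which \<open>1\<close> is the all-ones vector, \<open>\<le>\<close> is entrywise and \<open>\<bullet>\<close> is the
  Euclidean inner product.
\<close>

definition joint_vec :: "('y::finite \<times> 'z::finite) pmf \<Rightarrow> real^('y \<times> 'z)"
  where "joint_vec P = (\<chi> yz. pmf P yz)"

text \<open>The vector \<open>(y, z) \<mapsto> P\<^sub>Z(z)\<close>.\<close>

definition ones_marginal :: "('y::finite \<times> 'z::finite) pmf \<Rightarrow> real^('y \<times> 'z)"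
  where "ones_marginal P = (\<chi> yz. pmf (map_pmf snd P) (snd yz))"

text \<open>
  The two optimal values are written as infima of the feasible objective values; for
  \<open>0 \<le> \<epsilon>\<close> these infima are minima, see \<open>lambda_min_attained\<close> and
  \<open>lambda_bar_min_attained\<close> below.
\<close>

definition lambda_min_feasible :: "real \<Rightarrow> ('y::finite \<times> 'z::finite) pmf \<Rightarrow> real set"
  where "lambda_min_feasible \<epsilon> P =
    {l. \<exists>T Q :: real^('y \<times> 'z).
          Q \<le> l *\<^sub>R ones_marginal P \<and> joint_vec P - Q \<le> T \<and>
          1 \<bullet> T \<le> \<epsilon> \<and> 1 \<bullet> Q = 1 \<and> 0 \<le> l \<and> 0 \<le> T \<and> 0 \<le> Q}"

definition lambda_min :: "real \<Rightarrow> ('y::finite \<times> 'z::finite) pmf \<Rightarrow> real"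
  where "lambda_min \<epsilon> P = Inf (lambda_min_feasible \<epsilon> P)"

definition lambda_bar_min_feasible :: "real \<Rightarrow> ('y::finite \<times> 'z::finite) pmf \<Rightarrow> real set"
  where "lambda_bar_min_feasible \<epsilon> P =
    {l. \<exists>T Q :: real^('y \<times> 'z).
          Q \<le> l *\<^sub>R ones_marginal P \<and> joint_vec P - Q \<le> T \<and>
          1 \<bullet> T \<le> \<epsilon> \<and> 0 \<le> l \<and> 0 \<le> T \<and> 0 \<le> Q}"

definition lambda_bar_min :: "real \<Rightarrow> ('y::finite \<times> 'z::finite) pmf \<Rightarrow> real"
  where "lambda_bar_min \<epsilon> P = Inf (lambda_bar_min_feasible \<epsilon> P)"

lemma joint_vec_nonneg: "0 \<le> joint_vec P"
  by (simp add: joint_vec_def less_eq_vec_def)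

lemma ones_marginal_nonneg: "0 \<le> ones_marginal P"
  by (simp add: ones_marginal_def less_eq_vec_def)

lemma joint_vec_le_ones_marginal: "joint_vec P \<le> ones_marginal P"
proof -
  have "pmf P yz \<le> pmf (map_pmf snd P) (snd yz)" for yz
  proof -
    have "pmf P yz = measure (measure_pmf P) {yz}"
      by (simp add: measure_pmf_single)
    also have "\<dots> \<le> measure (measure_pmf P) (snd -` {snd yz})"
      by (intro measure_pmf.finite_measure_mono) auto
    finally show ?thesis by (simp add: pmf_map)
  qed
  then show ?thesis
    by (simp add: joint_vec_def ones_marginal_def less_eq_vec_def)
qed

lemma one_inner_vec: "1 \<bullet> v = (\<Sum>i\<in>UNIV. v $ i)" for v :: "real^'n"
  by (simp add: inner_vec_def)

lemma one_inner_joint_vec: "1 \<bullet> joint_vec P = 1"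
  unfolding one_inner_vec joint_vec_def by (simp add: sum_pmf_eq_1)

lemma lambda_min_feasible_1:
  assumes "0 \<le> \<epsilon>"
  shows "1 \<in> lambda_min_feasible \<epsilon> P"
  unfolding lambda_min_feasible_def
  using assms joint_vec_nonneg joint_vec_le_ones_marginal one_inner_joint_vec
  by (intro CollectI exI[of _ 0] exI[of _ "joint_vec P"]) auto

lemma lambda_min_feasible_subset: "lambda_min_feasible \<epsilon> P \<subseteq> lambda_bar_min_feasible \<epsilon> P"
  unfolding lambda_min_feasible_def lambda_bar_min_feasible_def by blast

lemma lp_attained:
  fixes P :: "('y::finite \<times> 'z::finite) pmf" and C :: "(real^('y \<times> 'z)) set" and \<epsilon> :: real
  assumes C: "closed C"
  defines "L \<equiv> {l. \<exists>T Q :: real^('y \<times> 'z).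
          Q \<le> l *\<^sub>R ones_marginal P \<and> joint_vec P - Q \<le> T \<and>
          1 \<bullet> T \<le> \<epsilon> \<and> Q \<in> C \<and> 0 \<le> l \<and> 0 \<le> T \<and> 0 \<le> Q}"
  assumes "1 \<in> L"
  shows "Inf L \<in> L"
proof -
  define F where "F = {(l, T, Q :: real^('y \<times> 'z)).
          Q \<le> l *\<^sub>R ones_marginal P \<and> joint_vec P - Q \<le> T \<and>
          1 \<bullet> T \<le> \<epsilon> \<and> Q \<in> C \<and> 0 \<le> l \<and> 0 \<le> T \<and> 0 \<le> Q \<and> l \<le> 1}"
  have F: "F = (\<Inter>i. {x. snd (snd x) $ i \<le> fst x * ones_marginal P $ i}) \<inter>
      (\<Inter>i. {x. joint_vec P $ i - snd (snd x) $ i \<le> fst (snd x) $ i}) \<inter>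
      {x. 1 \<bullet> fst (snd x) \<le> \<epsilon>} \<inter> (\<lambda>x. snd (snd x)) -` C \<inter> {x. 0 \<le> fst x} \<inter>
      (\<Inter>i. {x. 0 \<le> fst (snd x) $ i}) \<inter> (\<Inter>i. {x. 0 \<le> snd (snd x) $ i}) \<inter> {x. fst x \<le> 1}"
    unfolding F_def less_eq_vec_def by auto
  have "closed F"
    unfolding F
    by (intro closed_Int closed_INT ballI closed_Collect_le closed_vimage C continuous_intros)
  moreover have "F \<subseteq> {0..1} \<times> {0..\<epsilon> *\<^sub>R 1} \<times> {0..ones_marginal P}"
  proof (clarify, intro mem_Times_iff[THEN iffD2] conjI; simp)
    fix l and T Q :: "real^('y \<times> 'z)"
    assume "(l, T, Q) \<in> F"
    then have a: "Q \<le> l *\<^sub>R ones_marginal P" "1 \<bullet> T \<le> \<epsilon>" "0 \<le> l" "l \<le> 1" "0 \<le> T" "0 \<le> Q"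
      unfolding F_def by auto
    show "0 \<le> l \<and> l \<le> 1" using a by simp
    have "T $ i \<le> \<epsilon>" for i
    proof -
      have "T $ i \<le> (\<Sum>j\<in>UNIV. T $ j)"
        by (intro member_le_sum) (use a(5) in \<open>auto simp: less_eq_vec_def\<close>)
      then show ?thesis using a(2) by (simp add: one_inner_vec)
    qed
    then show "0 \<le> T \<and> T \<le> \<epsilon> *\<^sub>R 1"
      using a by (simp add: less_eq_vec_def)
    have "l *\<^sub>R ones_marginal P \<le> 1 *\<^sub>R ones_marginal P"
      by (intro scaleR_right_mono a ones_marginal_nonneg)
    then show "0 \<le> Q \<and> Q \<le> ones_marginal P"
      using a by simp
  qed
  moreover have "compact ({0..1::real} \<times> {0..\<epsilon> *\<^sub>R (1 :: real^('y \<times> 'z))} \<times> {0..ones_marginal P})"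
    by (intro compact_Times) (metis cbox_interval compact_cbox)+
  ultimately have "compact F"
    using compact_Int_closed inf.absorb_iff2 by metis
  moreover have "F \<noteq> {}"
  proof -
    from \<open>1 \<in> L\<close> obtain T Q where "(1, T, Q) \<in> F"
      unfolding L_def F_def mem_Collect_eq prod.case by blast
    then show ?thesis by blast
  qed
  ultimately obtain x where x: "x \<in> F" "\<And>y. y \<in> F \<Longrightarrow> fst x \<le> fst y"
    using continuous_attains_inf[of F fst] continuous_on_fst[OF continuous_on_id] by blast
  have "fst x \<in> L"
  proof -
    obtain l T Q where "x = (l, T, Q)" by (rule prod_cases3)
    moreover from this x(1) have "(l, T, Q) \<in> F" by (simp only:)
    then have "l \<in> L"
      unfolding L_def F_def mem_Collect_eq prod.case by (intro exI[of _ T] exI[of _ Q]) simp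
    ultimately show ?thesis by (simp only: fst_conv)
  qed
  moreover have "fst x \<le> l" if "l \<in> L" for l
  proof (cases "l \<le> 1")
    case True
    from that obtain T Q where "(l, T, Q) \<in> F"
      using True unfolding L_def F_def mem_Collect_eq prod.case by blast
    from x(2)[OF this] show ?thesis by (simp only: fst_conv)
  next
    case False
    moreover have "fst x \<le> 1" using x(1) unfolding F by blast
    ultimately show ?thesis by simp
  qed
  ultimately show ?thesis
    using cInf_eq_minimum[of "fst x" L] by simp
qed

lemma lambda_min_attained:
  assumes "0 \<le> \<epsilon>"
  shows "lambda_min \<epsilon> P \<in> lambda_min_feasible \<epsilon> P"
    and "\<And>l. l \<in> lambda_min_feasible \<epsilon> P \<Longrightarrow> lambda_min \<epsilon> P \<le> l"
proof -
  have "closed {Q :: real^('a \<times> 'b). 1 \<bullet> Q = 1}"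
    by (intro closed_Collect_eq continuous_intros)
  then show "lambda_min \<epsilon> P \<in> lambda_min_feasible \<epsilon> P"
    using lp_attained[of "{Q. 1 \<bullet> Q = 1}" P \<epsilon>] lambda_min_feasible_1[OF assms, of P]
    unfolding lambda_min_def lambda_min_feasible_def by simp
  show "lambda_min \<epsilon> P \<le> l" if "l \<in> lambda_min_feasible \<epsilon> P" for l
    unfolding lambda_min_def using that
    by (intro cInf_lower bdd_belowI[of _ 0]) (auto simp: lambda_min_feasible_def)
qed

lemma lambda_bar_min_attained:
  assumes "0 \<le> \<epsilon>"
  shows "lambda_bar_min \<epsilon> P \<in> lambda_bar_min_feasible \<epsilon> P"
    and "\<And>l. l \<in> lambda_bar_min_feasible \<epsilon> P \<Longrightarrow> lambda_bar_min \<epsilon> P \<le> l"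
proof -
  have "1 \<in> lambda_bar_min_feasible \<epsilon> P"
    using lambda_min_feasible_1[OF assms] lambda_min_feasible_subset by blast
  then show "lambda_bar_min \<epsilon> P \<in> lambda_bar_min_feasible \<epsilon> P"
    using lp_attained[of UNIV P \<epsilon>]
    unfolding lambda_bar_min_def lambda_bar_min_feasible_def by simp
  show "lambda_bar_min \<epsilon> P \<le> l" if "l \<in> lambda_bar_min_feasible \<epsilon> P" for l
    unfolding lambda_bar_min_def using that
    by (intro cInf_lower bdd_belowI[of _ 0]) (auto simp: lambda_bar_min_feasible_def)
qed

text \<open>Without normalization the variable \<open>Q\<close> can be eliminated.\<close>

lemma lambda_bar_min_feasible_eq:
  fixes P :: "('y::finite \<times> 'z::finite) pmf"
  shows "lambda_bar_min_feasible \<epsilon> P =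
    {l. \<exists>T :: real^('y \<times> 'z).
          joint_vec P - T \<le> l *\<^sub>R ones_marginal P \<and> 1 \<bullet> T \<le> \<epsilon> \<and> 0 \<le> l \<and> 0 \<le> T}"
    (is "_ = ?R")
proof (intro equalityI subsetI)
  fix l assume "l \<in> lambda_bar_min_feasible \<epsilon> P"
  then obtain T Q :: "real^('y \<times> 'z)" where
    a: "Q \<le> l *\<^sub>R ones_marginal P" "joint_vec P - Q \<le> T" "1 \<bullet> T \<le> \<epsilon>" "0 \<le> l" "0 \<le> T"
    unfolding lambda_bar_min_feasible_def by blast
  have "joint_vec P - T \<le> Q"
    using a(2) by (simp add: algebra_simps)
  then show "l \<in> ?R" using a order_trans by blast
next
  fix l assume "l \<in> ?R"
  then obtain T :: "real^('y \<times> 'z)" where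
    a: "joint_vec P - T \<le> l *\<^sub>R ones_marginal P" "1 \<bullet> T \<le> \<epsilon>" "0 \<le> l" "0 \<le> T"
    by blast
  have "joint_vec P - l *\<^sub>R ones_marginal P \<le> T"
    using a(1) by (simp add: algebra_simps)
  moreover have "0 \<le> l *\<^sub>R ones_marginal P"
    using a(3) ones_marginal_nonneg by (rule scaleR_nonneg_nonneg)
  ultimately show "l \<in> lambda_bar_min_feasible \<epsilon> P"
    unfolding lambda_bar_min_feasible_def using a by blast
qed

end

theory Submission
  imports Defs
begin

text \<open>
  An optimal \<open>Q\<close> of the relaxed program may be taken to be the entrywise minimum of \<open>P\<close> and
  \<open>U = \<lambda> \<one>\<^sub>Y P\<^sub>Z\<close>, whose total mass is at most \<open>1\<close>. As \<open>U\<close> has mass \<open>\<lambda>|Y| \<ge> 1\<close>, some point of the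
  segment from \<open>Q\<close> to \<open>U\<close> has mass exactly \<open>1\<close>. Raising \<open>Q\<close> within \<open>U\<close> keeps all other
  constraints, so \<open>\<lambda>\<close> is feasible for the normalized program.
\<close>

text \<open>Each of the \<open>CARD('y)\<close> rows is a copy of the marginal and sums to
  1.\<close>

lemma one_inner_ones_marginal:
  fixes P :: "('y::finite \<times> 'z::finite) pmf"
  shows "1 \<bullet> ones_marginal P = real CARD('y)"
proof -
  have "1 \<bullet> ones_marginal P = (\<Sum>yz\<in>UNIV \<times> UNIV. pmf (map_pmf snd P) (snd (yz :: 'y \<times> 'z)))"
    by (simp add: one_inner_vec ones_marginal_def)
  also have "\<dots> = (\<Sum>y\<in>(UNIV :: 'y set). \<Sum>z\<in>UNIV. pmf (map_pmf snd P) z)"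
    by (simp only: sum.cartesian_product case_prod_unfold)
  also have "\<dots> = real CARD('y)"
    by (simp add: sum_pmf_eq_1)
  finally show ?thesis .
qed

text \<open>Mass is continuous along the segment from \<open>A\<close> to \<open>B\<close>, so the
  intermediate value theorem gives a point of mass \<open>c\<close>.\<close>

lemma exists_between_with_mass:
  fixes A B :: "real^'n"
  assumes "A \<le> B" and "1 \<bullet> A \<le> c" and "c \<le> 1 \<bullet> B"
  obtains Q where "A \<le> Q" "Q \<le> B" "1 \<bullet> Q = c"
proof -
  let ?Q = "\<lambda>t. A + t *\<^sub>R (B - A)"
  have "continuous_on {0..1} (\<lambda>t. 1 \<bullet> ?Q t)"
    by (intro continuous_intros)
  then obtain t where t: "0 \<le> t" "t \<le> 1" "1 \<bullet> ?Q t = c"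
    using IVT'[of "\<lambda>t. 1 \<bullet> ?Q t" 0 c 1] assms(2,3) by auto
  have "0 \<le> t *\<^sub>R (B - A)"
    using t(1) assms(1) by (intro scaleR_nonneg_nonneg) auto
  moreover have "t *\<^sub>R (B - A) \<le> 1 *\<^sub>R (B - A)"
    using t(2) assms(1) by (intro scaleR_right_mono) auto
  ultimately show ?thesis
    using t(3) by (intro that[of "?Q t"]) (auto simp: algebra_simps)
qed

lemma lambda_bar_min_feasible_imp_lambda_min_feasible:
  fixes P :: "('y::finite \<times> 'z::finite) pmf"
  assumes "l \<in> lambda_bar_min_feasible \<epsilon> P" and "1 / real CARD('y) \<le> l"
  shows "l \<in> lambda_min_feasible \<epsilon> P"
proof -
  let ?U = "l *\<^sub>R ones_marginal P"
  obtain T :: "real^('y \<times> 'z)" where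
    T: "joint_vec P - T \<le> ?U" "1 \<bullet> T \<le> \<epsilon>" "0 \<le> l" "0 \<le> T"
    using assms(1) unfolding lambda_bar_min_feasible_eq by blast
  \<comment> \<open>An arbitrary feasible \<open>Q\<close> may have mass above 1; capping by
    \<open>joint_vec P\<close> rules this out.\<close>
  define A where "A = (\<chi> i. min (joint_vec P $ i) (?U $ i))"
  have "0 \<le> ?U"
    using T(3) ones_marginal_nonneg by (rule scaleR_nonneg_nonneg)
  then have A: "0 \<le> A" "A \<le> ?U" "A \<le> joint_vec P"
    using joint_vec_nonneg[of P] by (simp_all add: A_def less_eq_vec_def)
  \<comment> \<open>Entrywise the left side is either 0 or the excess of \<open>joint_vec P\<close>
    over \<open>?U\<close>; \<open>T\<close> dominates both.\<close>
  have AT: "joint_vec P - A \<le> T"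
    using T(1,4) by (auto simp: A_def less_eq_vec_def min_def algebra_simps)
  have "1 \<bullet> A \<le> 1 \<bullet> joint_vec P"
    unfolding one_inner_vec using A(3) by (intro sum_mono) (simp only: less_eq_vec_def)
  then have "1 \<bullet> A \<le> 1"
    by (simp add: one_inner_joint_vec)
  \<comment> \<open>The threshold \<open>1 / CARD('y)\<close> is exactly the \<open>l\<close> at
    which \<open>?U\<close> has mass 1.\<close>
  moreover have "1 \<le> 1 \<bullet> ?U"
    using assms(2) by (simp add: one_inner_ones_marginal field_simps)
  ultimately obtain Q where Q: "A \<le> Q" "Q \<le> ?U" "1 \<bullet> Q = 1"
    using exists_between_with_mass[OF A(2)] by blast
  have "0 \<le> Q" "joint_vec P - Q \<le> T"
    using A(1) Q(1) AT diff_left_mono[OF Q(1), of "joint_vec P"] by (blast intro: order_trans)+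
  with Q T show ?thesis
    unfolding lambda_min_feasible_def by blast
qed

theorem proposition3:
  fixes P :: "('y::finite \<times> 'z::finite) pmf" and \<epsilon> :: real
  assumes "0 \<le> \<epsilon>" and "\<epsilon> < 1"
    and "lambda_bar_min \<epsilon> P > 1 / real CARD('y)"
  shows "lambda_bar_min \<epsilon> P = lambda_min \<epsilon> P"
proof (rule antisym)
  show "lambda_bar_min \<epsilon> P \<le> lambda_min \<epsilon> P"
    using lambda_bar_min_attained(2) lambda_min_attained(1) lambda_min_feasible_subset assms(1)
    by blast
  have "lambda_bar_min \<epsilon> P \<in> lambda_min_feasible \<epsilon> P"
    using assms(3) lambda_bar_min_attained(1)[OF assms(1)]
    by (intro lambda_bar_min_feasible_imp_lambda_min_feasible) auto
  then show "lambda_min \<epsilon> P \<le> lambda_bar_min \<epsilon> P"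
    using assms(1) by (intro lambda_min_attained(2))
qed

end
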